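(* Let $(X,\mu)$ be a uniform space. The following statements are equivalent: (1) $(X,\mu)$ is uniformly strongly paracompact; (2) $(X,\mu)$ is uniformly paracompact and $\mu=s_f\mu$; (3) $(X,\mu)$ is cofinally complete and $\mu=s_f\mu$; (4) $(X,\mu)$ is cofinally Bourbaki-complete.
   Context: Uniform spaces are Hausdorff and given by covers: $\mu$ is a family of covers of $X$ (the uniform covers), containing every cover refined by a member of $\mu$, and such that any two members of $\mu$ have a common star-refinement in $\mu$. For a cover $\mathcal U$ of $X$ and $A\subset X$: $St(A,\mathcal U)=\bigcup\{U\in\mathcal U: U\cap A\neq\emptyset\}$, $St^0(A,\mathcal U)=A$, $St^m(A,\mathcal U)=St(St^{m-1}(A,\mathcal U),\mathcal U)$ for $m\geq 1$. $(X,\mu)$ is uniformly paracompact if every open cover of $X$ has an open refinement $\mathcal A$ that is uniformly locally finite, i.e. there is $\mathcal U\in\mu$ such that every $U\in\mathcal U$ meets at most finitely many $A\in\mathcal A$. $(X,\mu)$ is uniformly strongly paracompact if every open cover of $X$ has an open refinement $\mathcal A$ that is uniformly star-finite, i.e. there is $\mathcal U\in\mu$ such that for every $A\in\mathcal A$ the set $St(A,\mathcal U)$ meets at most finitely many $A'\in\mathcal A$. A filter $\mathcal F$ on $X$ is cofinally Cauchy if for every $\mathcal U\in\mu$ there is $U\in\mathcal U$ with $F\cap U\neq\emptyset$ for all $F\in\mathcal F$; it is cofinally Bourbaki-Cauchy if for every $\mathcal U\in\mu$ there are $m\in\mathbb N$ and $U\in\mathcal U$ with $F\cap St^m(U,\mathcal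 U)\neq\emptyset$ for all $F\in\mathcal F$. $(X,\mu)$ is cofinally complete (respectively cofinally Bourbaki-complete) if every cofinally Cauchy (respectively cofinally Bourbaki-Cauchy) filter has a cluster point. A cover is star-finite if each of its members meets at most finitely many of its members. $s_f\mu$ denotes the uniformity on $X$ having as a base the family of all star-finite open covers belonging to $\mu$; thus $\mu=s_f\mu$ means that $\mu$ has a base of star-finite open covers. *)

theory Defs
  imports "HOL-Analysis.Analysis"
begin

definition is_cover :: "'a set \<Rightarrow> 'a set set \<Rightarrow> bool" where
  "is_cover X \<U> \<longleftrightarrow> \<Union>\<U> = X"

definition refines :: "'a set set \<Rightarrow> 'a set set \<Rightarrow> bool" where
  "refines \<V> \<U> \<longleftrightarrow> (\<forall>V\<in>\<V>. \<exists>U\<in>\<U>. V \<subseteq> U)"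

definition St :: "'a set \<Rightarrow> 'a set set \<Rightarrow> 'a set" where
  "St A \<U> = \<Union>{U \<in> \<U>. U \<inter> A \<noteq> {}}"

primrec St_iter :: "nat \<Rightarrow> 'a set \<Rightarrow> 'a set set \<Rightarrow> 'a set" where
  "St_iter 0 A \<U> = A"
| "St_iter (Suc m) A \<U> = St (St_iter m A \<U>) \<U>"

definition star_refines :: "'a set set \<Rightarrow> 'a set set \<Rightarrow> bool" where
  "star_refines \<V> \<U> \<longleftrightarrow> refines ((\<lambda>V. St V \<V>) ` \<V>) \<U>"

text \<open>The condition \<open>\<mu> \<noteq> {}\<close> is the usual tacit one; together with upward closure it says
  that the one-element cover \<open>{X}\<close> is uniform.\<close>

definition covering_uniformity :: "'a set \<Rightarrow> 'a set set set \<Rightarrow> bool" where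
  "covering_uniformity X \<mu> \<longleftrightarrow>
     \<mu> \<noteq> {} \<and>
     (\<forall>\<U>\<in>\<mu>. is_cover X \<U>) \<and>
     (\<forall>\<U>\<in>\<mu>. \<forall>\<V>. is_cover X \<V> \<and> refines \<U> \<V> \<longrightarrow> \<V> \<in> \<mu>) \<and>
     (\<forall>\<U>\<in>\<mu>. \<forall>\<V>\<in>\<mu>. \<exists>\<W>\<in>\<mu>. star_refines \<W> \<U> \<and> star_refines \<W> \<V>)"

definition unif_topology :: "'a set \<Rightarrow> 'a set set set \<Rightarrow> 'a topology" where
  "unif_topology X \<mu> =
     topology (\<lambda>G. G \<subseteq> X \<and> (\<forall>x\<in>G. \<exists>\<U>\<in>\<mu>. St {x} \<U> \<subseteq> G))"

lemma star_refines_St_point: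
  assumes "star_refines \<W> \<U>"
  shows "St {x} \<W> \<subseteq> St {x} \<U>"
proof
  fix y assume "y \<in> St {x} \<W>"
  then obtain W where W: "W \<in> \<W>" "x \<in> W" "y \<in> W"
    by (auto simp: St_def)
  with assms obtain U where "U \<in> \<U>" "St W \<W> \<subseteq> U"
    by (auto simp: star_refines_def refines_def)
  moreover have "W \<subseteq> St W \<W>"
    using W by (auto simp: St_def)
  ultimately show "y \<in> St {x} \<U>"
    using W by (auto simp: St_def)
qed

lemma openin_unif_topology:
  assumes "covering_uniformity X \<mu>"
  shows "openin (unif_topology X \<mu>) G \<longleftrightarrow>
           G \<subseteq> X \<and> (\<forall>x\<in>G. \<exists>\<U>\<in>\<mu>. St {x} \<U> \<subseteq> G)"
proof -
  have "istopology (\<lambda>G. G \<subseteq> X \<and> (\<forall>x\<in>G. \<exists>\<U>\<in>\<mu>. St {x} \<U> \<subseteq> G))" (is "istopology ?P")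
    unfolding istopology_def
  proof (intro conjI allI impI)
    fix S T assume S: "?P S" and T: "?P T"
    show "S \<inter> T \<subseteq> X" using S by blast
    show "\<forall>x\<in>S \<inter> T. \<exists>\<U>\<in>\<mu>. St {x} \<U> \<subseteq> S \<inter> T"
    proof
      fix x assume "x \<in> S \<inter> T"
      then have "\<exists>\<U>\<in>\<mu>. St {x} \<U> \<subseteq> S" "\<exists>\<V>\<in>\<mu>. St {x} \<V> \<subseteq> T"
        using S T by auto
      then obtain \<U> \<V> where UV: "\<U> \<in> \<mu>" "St {x} \<U> \<subseteq> S" "\<V> \<in> \<mu>" "St {x} \<V> \<subseteq> T"
        by auto
      then obtain \<W> where "\<W> \<in> \<mu>" "star_refines \<W> \<U>" "star_refines \<W> \<V>"
        using assms unfolding covering_uniformity_def by blast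
      then show "\<exists>\<U>\<in>\<mu>. St {x} \<U> \<subseteq> S \<inter> T"
        using UV star_refines_St_point[of \<W> \<U> x] star_refines_St_point[of \<W> \<V> x] by blast
    qed
  next
    fix \<K> assume K: "\<forall>K\<in>\<K>. ?P K"
    show "\<Union>\<K> \<subseteq> X" using K by blast
    show "\<forall>x\<in>\<Union>\<K>. \<exists>\<U>\<in>\<mu>. St {x} \<U> \<subseteq> \<Union>\<K>"
    proof
      fix x assume "x \<in> \<Union>\<K>"
      then obtain K where "K \<in> \<K>" "x \<in> K" by (rule UnionE)
      moreover from this obtain \<U> where "\<U> \<in> \<mu>" "St {x} \<U> \<subseteq> K"
        using K by meson
      ultimately show "\<exists>\<U>\<in>\<mu>. St {x} \<U> \<subseteq> \<Union>\<K>"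
        by (meson Union_upper order_trans)
    qed
  qed
  then show ?thesis
    by (simp add: unif_topology_def topology_inverse')
qed

lemma topspace_unif_topology:
  assumes "covering_uniformity X \<mu>"
  shows "topspace (unif_topology X \<mu>) = X"
proof
  show "topspace (unif_topology X \<mu>) \<subseteq> X"
    using openin_topspace[of "unif_topology X \<mu>"]
    unfolding openin_unif_topology[OF assms] by (rule conjunct1)
  from assms have "\<mu> \<noteq> {}" "\<forall>\<U>\<in>\<mu>. \<Union>\<U> = X"
    by (simp_all add: covering_uniformity_def is_cover_def)
  then obtain \<U> where "\<U> \<in> \<mu>" "\<Union>\<U> = X"
    by auto
  then have "St {x} \<U> \<subseteq> X" for x
    by (auto simp: St_def)
  then have "openin (unif_topology X \<mu>) X"
    using \<open>\<U> \<in> \<mu>\<close> by (auto simp: openin_unif_topology[OF assms])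
  then show "X \<subseteq> topspace (unif_topology X \<mu>)"
    by (rule openin_subset)
qed

definition hausdorff_uniform_space :: "'a set \<Rightarrow> 'a set set set \<Rightarrow> bool" where
  "hausdorff_uniform_space X \<mu> \<longleftrightarrow>
     covering_uniformity X \<mu> \<and> Hausdorff_space (unif_topology X \<mu>)"

definition open_cover :: "'a set \<Rightarrow> 'a set set set \<Rightarrow> 'a set set \<Rightarrow> bool" where
  "open_cover X \<mu> \<A> \<longleftrightarrow> is_cover X \<A> \<and> (\<forall>A\<in>\<A>. openin (unif_topology X \<mu>) A)"

definition unif_locally_finite :: "'a set set set \<Rightarrow> 'a set set \<Rightarrow> bool" where
  "unif_locally_finite \<mu> \<A> \<longleftrightarrow> (\<exists>\<U>\<in>\<mu>. \<forall>U\<in>\<U>. finite {A \<in> \<A>. U \<inter> A \<noteq> {}})"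

definition unif_star_finite :: "'a set set set \<Rightarrow> 'a set set \<Rightarrow> bool" where
  "unif_star_finite \<mu> \<A> \<longleftrightarrow> (\<exists>\<U>\<in>\<mu>. \<forall>A\<in>\<A>. finite {A' \<in> \<A>. St A \<U> \<inter> A' \<noteq> {}})"

definition unif_paracompact :: "'a set \<Rightarrow> 'a set set set \<Rightarrow> bool" where
  "unif_paracompact X \<mu> \<longleftrightarrow>
     (\<forall>\<G>. open_cover X \<mu> \<G> \<longrightarrow>
        (\<exists>\<A>. open_cover X \<mu> \<A> \<and> refines \<A> \<G> \<and> unif_locally_finite \<mu> \<A>))"

definition unif_strongly_paracompact :: "'a set \<Rightarrow> 'a set set set \<Rightarrow> bool" where
  "unif_strongly_paracompact X \<mu> \<longleftrightarrow>
     (\<forall>\<G>. open_cover X \<mu> \<G> \<longrightarrow>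
        (\<exists>\<A>. open_cover X \<mu> \<A> \<and> refines \<A> \<G> \<and> unif_star_finite \<mu> \<A>))"

text \<open>A filter on the carrier \<open>X\<close> is a proper library filter to which \<open>X\<close> belongs;
  a set \<open>F\<close> belongs to the filter \<open>\<F>\<close> when \<open>eventually (\<lambda>x. x \<in> F) \<F>\<close>.\<close>

definition filter_on :: "'a set \<Rightarrow> 'a filter \<Rightarrow> bool" where
  "filter_on X \<F> \<longleftrightarrow> \<F> \<noteq> bot \<and> eventually (\<lambda>x. x \<in> X) \<F>"

definition cofinally_Cauchy :: "'a set set set \<Rightarrow> 'a filter \<Rightarrow> bool" where
  "cofinally_Cauchy \<mu> \<F> \<longleftrightarrow>
     (\<forall>\<U>\<in>\<mu>. \<exists>U\<in>\<U>. \<forall>F. eventually (\<lambda>x. x \<in> F) \<F> \<longrightarrow> F \<inter> U \<noteq> {})"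

definition cofinally_Bourbaki_Cauchy :: "'a set set set \<Rightarrow> 'a filter \<Rightarrow> bool" where
  "cofinally_Bourbaki_Cauchy \<mu> \<F> \<longleftrightarrow>
     (\<forall>\<U>\<in>\<mu>. \<exists>m. \<exists>U\<in>\<U>. \<forall>F. eventually (\<lambda>x. x \<in> F) \<F> \<longrightarrow> F \<inter> St_iter m U \<U> \<noteq> {})"

definition cluster_point :: "'a topology \<Rightarrow> 'a filter \<Rightarrow> 'a \<Rightarrow> bool" where
  "cluster_point T \<F> x \<longleftrightarrow>
     x \<in> topspace T \<and> (\<forall>F. eventually (\<lambda>y. y \<in> F) \<F> \<longrightarrow> x \<in> T closure_of F)"

definition cofinally_complete :: "'a set \<Rightarrow> 'a set set set \<Rightarrow> bool" where
  "cofinally_complete X \<mu> \<longleftrightarrow>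
     (\<forall>\<F>. filter_on X \<F> \<and> cofinally_Cauchy \<mu> \<F> \<longrightarrow>
        (\<exists>x. cluster_point (unif_topology X \<mu>) \<F> x))"

definition cofinally_Bourbaki_complete :: "'a set \<Rightarrow> 'a set set set \<Rightarrow> bool" where
  "cofinally_Bourbaki_complete X \<mu> \<longleftrightarrow>
     (\<forall>\<F>. filter_on X \<F> \<and> cofinally_Bourbaki_Cauchy \<mu> \<F> \<longrightarrow>
        (\<exists>x. cluster_point (unif_topology X \<mu>) \<F> x))"

definition star_finite :: "'a set set \<Rightarrow> bool" where
  "star_finite \<U> \<longleftrightarrow> (\<forall>U\<in>\<U>. finite {V \<in> \<U>. U \<inter> V \<noteq> {}})"

text \<open>The uniformity with a given base consists of all covers refined by a member of the base.\<close>

definition sf_unif :: "'a set \<Rightarrow> 'a set set set \<Rightarrow> 'a set set set" where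
  "sf_unif X \<mu> =
     {\<U>. is_cover X \<U> \<and> (\<exists>\<V>\<in>\<mu>. open_cover X \<mu> \<V> \<and> star_finite \<V> \<and> refines \<V> \<U>)}"

end

theory Submission
  imports Defs
begin

text \<open>
  The equivalence is proved as a cycle of implications.

  From uniform strong paracompactness: a uniformly star-finite open cover \<open>\<A>\<close> is uniformly
  locally finite. Moreover, if \<open>\<A>\<close> is fine enough, thickening its members to \<open>St A \<V>\<close>, for a
  sufficiently fine open uniform cover \<open>\<V>\<close>, turns it into a uniform cover that is star-finite and
  refines a prescribed uniform cover; so the star-finite open covers form a base
  (lemma \<open>unif_strongly_paracompact_imp_sf_unif\<close>).

  From uniform paracompactness: if a filter has no cluster point, then the complements of the
  closures of its members form an open cover. A uniformly locally finite refinement of it yields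
  a uniform cover each member of which misses some member of the filter
  (lemma \<open>unif_paracompact_imp_cofinally_complete\<close>).

  From a base of star-finite covers: an iterated star of a member of a star-finite cover is a
  finite union of members. If it meets every set of a filter, so does one of these members;
  hence cofinally Bourbaki-Cauchy filters are cofinally Cauchy
  (lemma \<open>cofinally_Bourbaki_Cauchy_imp_cofinally_Cauchy\<close>).

  From cofinal Bourbaki-completeness: given an open cover \<open>\<G>\<close>, the complements of the finite
  unions from \<open>\<G>\<close> generate a filter without cluster point. As this filter is not cofinally
  Bourbaki-Cauchy, there is an open uniform cover \<open>\<U>\<close> all of whose iterated stars lie in finite
  unions from \<open>\<G>\<close> (lemma \<open>ex_iterated_stars_finitely_covered\<close>). Each chain component of \<open>\<U>\<close> is
  sliced into layers according to the distance, counted in links of chains, from a base member of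
  the component. Each layer lies in an iterated star and so is covered by finitely many members of
  \<open>\<G>\<close>, and a member of \<open>\<U>\<close> meets only its own layer and the adjacent ones.
  The traces of these finitely many members on the layers form the required uniformly star-finite refinement
  (lemma \<open>cofinally_Bourbaki_complete_imp_unif_strongly_paracompact\<close>).
\<close>

section \<open>Covers and stars\<close>

lemma refines_trans: "refines \<U> \<V> \<Longrightarrow> refines \<V> \<W> \<Longrightarrow> refines \<U> \<W>"
  unfolding refines_def by (meson order_trans)

lemma subset_St: "A \<subseteq> \<Union>\<U> \<Longrightarrow> A \<subseteq> St A \<U>"
  by (auto simp: St_def)

lemma St_mono:
  assumes "A \<subseteq> B" "refines \<V> \<U>"
  shows "St A \<V> \<subseteq> St B \<U>"
proof
  fix x assume "x \<in> St A \<V>"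
  then obtain V where V: "V \<in> \<V>" "V \<inter> A \<noteq> {}" "x \<in> V" by (auto simp: St_def)
  then obtain U where "U \<in> \<U>" "V \<subseteq> U" using assms(2) by (auto simp: refines_def)
  then show "x \<in> St B \<U>" using V assms(1) by (fastforce simp: St_def)
qed

lemma St_iter_mono:
  assumes "A \<subseteq> B" "refines \<V> \<U>"
  shows "St_iter m A \<V> \<subseteq> St_iter m B \<U>"
  by (induction m) (simp_all add: assms St_mono)

lemma star_refines_imp_refines:
  assumes "star_refines \<W> \<U>"
  shows "refines \<W> \<U>"
  unfolding refines_def
proof
  fix W assume W: "W \<in> \<W>"
  then obtain U where "U \<in> \<U>" "St W \<W> \<subseteq> U"
    using assms by (auto simp: star_refines_def refines_def)
  then show "\<exists>U\<in>\<U>. W \<subseteq> U" using W subset_St[of W \<W>] by blast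
qed

text \<open>In a star-finite family the iterated stars of a member are finite unions of members.\<close>

lemma star_finite_St_iter:
  assumes "star_finite \<V>" "V \<in> \<V>"
  shows "\<exists>\<H>. finite \<H> \<and> \<H> \<subseteq> \<V> \<and> St_iter m V \<V> = \<Union>\<H>"
proof (induction m)
  case 0
  show ?case using assms(2) by (intro exI[of _ "{V}"]) auto
next
  case (Suc m)
  then obtain \<H> where \<H>: "finite \<H>" "\<H> \<subseteq> \<V>" "St_iter m V \<V> = \<Union>\<H>" by (elim exE conjE)
  define \<K> where "\<K> = (\<Union>H\<in>\<H>. {V' \<in> \<V>. H \<inter> V' \<noteq> {}})"
  have "finite \<K>"
    unfolding \<K>_def using \<H> assms(1) by (auto simp: star_finite_def)
  moreover have "\<K> \<subseteq> \<V>" by (auto simp: \<K>_def)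
  moreover have "St_iter (Suc m) V \<V> = \<Union>\<K>"
    by (auto simp: \<H> St_def \<K>_def)
  ultimately show ?case by blast
qed

text \<open>
  Slicing of the chain components of a cover: \<open>r U\<close> is a base member of the chain component
  of \<open>U\<close>, and \<open>n U\<close> is the least number of links in a chain of members from \<open>r U\<close> to \<open>U\<close>.
\<close>

lemma ex_chain_levels:
  fixes \<U> :: "'a set set"
  shows "\<exists>(r :: 'a set \<Rightarrow> 'a set) (n :: 'a set \<Rightarrow> nat).
    (\<forall>U\<in>\<U>. r U \<in> \<U> \<and> U \<subseteq> St_iter (n U) (r U) \<U>) \<and>
    (\<forall>U\<in>\<U>. \<forall>V\<in>\<U>. U \<inter> V \<noteq> {} \<longrightarrow> r U = r V \<and> n V \<le> Suc (n U))"
proof -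
  define E where "E = {(U, V). U \<in> \<U> \<and> V \<in> \<U> \<and> U \<inter> V \<noteq> {}}"
  have symE: "sym E" by (auto simp: E_def sym_def)
  define r where "r U = (SOME V. V \<in> E\<^sup>* `` {U})" for U
  define n where "n U = (LEAST m. (r U, U) \<in> E ^^ m)" for U
  have r: "(U, r U) \<in> E\<^sup>*" for U
  proof -
    have "r U \<in> E\<^sup>* `` {U}" unfolding r_def by (rule someI[of _ U]) auto
    then show ?thesis by auto
  qed
  have mem: "V \<in> \<U>" if "(U, V) \<in> E\<^sup>*" "U \<in> \<U>" for U V
    using that by (induction rule: rtrancl_induct) (auto simp: E_def)
  have n: "(r U, U) \<in> E ^^ n U" for U
  proof -
    have "(r U, U) \<in> E\<^sup>*" using r[of U] symE by (meson sym_rtrancl symD)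
    then obtain m where "(r U, U) \<in> E ^^ m" by (auto simp: rtrancl_power)
    then show ?thesis unfolding n_def by (rule LeastI)
  qed
  have sub: "V \<subseteq> St_iter m U \<U>" if "(U, V) \<in> E ^^ m" for U V m
    using that
  proof (induction m arbitrary: V)
    case (Suc m)
    then obtain W where W: "(U, W) \<in> E ^^ m" "(W, V) \<in> E" by auto
    have "V \<in> \<U>" "V \<inter> W \<noteq> {}" using W by (auto simp: E_def)
    then show ?case using Suc.IH[OF W(1)] by (auto simp: St_def)
  qed auto
  have adj: "r U = r V \<and> n V \<le> Suc (n U)" if "(U, V) \<in> E" for U V
  proof
    have "E\<^sup>* `` {U} = E\<^sup>* `` {V}"
      using that symE by (auto dest: symD intro: converse_rtrancl_into_rtrancl)
    then show eq: "r U = r V" by (simp add: r_def)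
    have "(r V, V) \<in> E ^^ Suc (n U)"
      using n[of U] that eq by auto
    then show "n V \<le> Suc (n U)" unfolding n_def[of V] by (rule Least_le)
  qed
  show ?thesis
    using mem[OF r] sub[OF n] adj
    by (intro exI[of _ r] exI[of _ n]) (auto simp: E_def)
qed

section \<open>Uniform covers\<close>

lemma uniform_cover_upward:
  "covering_uniformity X \<mu> \<Longrightarrow> \<U> \<in> \<mu> \<Longrightarrow> is_cover X \<V> \<Longrightarrow> refines \<U> \<V> \<Longrightarrow> \<V> \<in> \<mu>"
  unfolding covering_uniformity_def by blast

lemma uniform_cover_Union: "covering_uniformity X \<mu> \<Longrightarrow> \<U> \<in> \<mu> \<Longrightarrow> \<Union>\<U> = X"
  by (simp add: covering_uniformity_def is_cover_def)

lemma ex_common_star_refinement: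
  assumes "covering_uniformity X \<mu>" "\<U> \<in> \<mu>" "\<V> \<in> \<mu>"
  obtains \<W> where "\<W> \<in> \<mu>" "star_refines \<W> \<U>" "star_refines \<W> \<V>"
  using assms unfolding covering_uniformity_def by blast

text \<open>The interiors of the members of a uniform cover again form a uniform cover.\<close>

lemma ex_open_uniform_refinement:
  assumes cu: "covering_uniformity X \<mu>" and "\<U> \<in> \<mu>"
  obtains \<V> where "\<V> \<in> \<mu>" "open_cover X \<mu> \<V>" "refines \<V> \<U>"
proof -
  let ?T = "unif_topology X \<mu>"
  obtain \<W> where \<W>: "\<W> \<in> \<mu>" "star_refines \<W> \<U>"
    using ex_common_star_refinement[OF cu assms(2,2)] by blast
  define \<V> where "\<V> = (\<lambda>U. ?T interior_of U) ` \<U>"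
  have ref: "refines \<W> \<V>"
    unfolding refines_def
  proof
    fix W assume W: "W \<in> \<W>"
    then obtain U where U: "U \<in> \<U>" "St W \<W> \<subseteq> U"
      using \<W>(2) by (auto simp: star_refines_def refines_def)
    have "W \<subseteq> ?T interior_of U"
    proof
      fix x assume x: "x \<in> W"
      \<comment> \<open>The set of all points one of whose uniform stars lies in \<open>U\<close> is open.\<close>
      define G where "G = {y \<in> X. \<exists>\<W>'\<in>\<mu>. St {y} \<W>' \<subseteq> U}"
      have "openin ?T G"
        unfolding openin_unif_topology[OF cu]
      proof (intro conjI ballI)
        show "G \<subseteq> X" by (auto simp: G_def)
        fix y assume "y \<in> G"
        then obtain \<W>' where \<W>': "\<W>' \<in> \<mu>" "St {y} \<W>' \<subseteq> U" by (auto simp: G_def)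
        obtain \<W>'' where w: "\<W>'' \<in> \<mu>" "star_refines \<W>'' \<W>'"
          using ex_common_star_refinement[OF cu \<W>'(1) \<W>'(1)] by blast
        have "St {y} \<W>'' \<subseteq> G"
        proof
          fix z assume "z \<in> St {y} \<W>''"
          then obtain Q where Q: "Q \<in> \<W>''" "y \<in> Q" "z \<in> Q" by (auto simp: St_def)
          then obtain P where P: "P \<in> \<W>'" "St Q \<W>'' \<subseteq> P"
            using w(2) by (auto simp: star_refines_def refines_def)
          have "y \<in> St Q \<W>''" using Q by (auto simp: St_def)
          then have "P \<subseteq> U" using P \<W>'(2) by (auto simp: St_def)
          moreover have "St {z} \<W>'' \<subseteq> St Q \<W>''" using Q by (auto simp: St_def)
          moreover have "z \<in> X" using uniform_cover_Union[OF cu w(1)] Q by blast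
          ultimately show "z \<in> G" using P(2) w(1) by (auto simp: G_def)
        qed
        then show "\<exists>\<U>\<in>\<mu>. St {y} \<U> \<subseteq> G" using w(1) by blast
      qed
      moreover have "G \<subseteq> U"
      proof
        fix y assume "y \<in> G"
        then obtain \<W>' where "y \<in> X" "\<W>' \<in> \<mu>" "St {y} \<W>' \<subseteq> U" by (auto simp: G_def)
        then show "y \<in> U" using uniform_cover_Union[OF cu] subset_St[of "{y}" \<W>'] by blast
      qed
      moreover have "x \<in> G"
      proof -
        have "St {x} \<W> \<subseteq> U" using x W U by (auto simp: St_def)
        moreover have "x \<in> X" using uniform_cover_Union[OF cu \<W>(1)] x W by blast
        ultimately show ?thesis using \<W>(1) by (auto simp: G_def)
      qed
      ultimately show "x \<in> ?T interior_of U" by (auto simp: interior_of_def)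
    qed
    then show "\<exists>V\<in>\<V>. W \<subseteq> V" using U(1) by (auto simp: \<V>_def)
  qed
  have "\<Union>\<V> \<subseteq> X"
    using interior_of_subset_topspace[of ?T]
    by (auto simp: \<V>_def topspace_unif_topology[OF cu])
  moreover have "X \<subseteq> \<Union>\<V>"
    using uniform_cover_Union[OF cu \<W>(1)] ref unfolding refines_def by blast
  ultimately have cov: "is_cover X \<V>" by (auto simp: is_cover_def)
  show thesis
  proof
    show "\<V> \<in> \<mu>" using uniform_cover_upward[OF cu \<W>(1) cov ref] .
    show "open_cover X \<mu> \<V>" using cov by (auto simp: open_cover_def \<V>_def)
    show "refines \<V> \<U>" unfolding refines_def \<V>_def using interior_of_subset[of ?T] by blast
  qed
qed

section \<open>Uniform strong paracompactness and star-finite bases\<close>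

lemma unif_strongly_paracompact_imp_unif_paracompact:
  assumes "unif_strongly_paracompact X \<mu>"
  shows "unif_paracompact X \<mu>"
proof -
  have "unif_locally_finite \<mu> \<A>" if sf: "unif_star_finite \<mu> \<A>" for \<A> :: "'a set set"
  proof -
    obtain \<U> where \<U>: "\<U> \<in> \<mu>" "\<forall>A\<in>\<A>. finite {A' \<in> \<A>. St A \<U> \<inter> A' \<noteq> {}}"
      using sf by (auto simp: unif_star_finite_def)
    have "finite {A \<in> \<A>. U \<inter> A \<noteq> {}}" if U: "U \<in> \<U>" for U
    proof (cases "\<exists>A\<in>\<A>. U \<inter> A \<noteq> {}")
      case True
      then obtain A where A: "A \<in> \<A>" "U \<inter> A \<noteq> {}" by blast
      then have "U \<subseteq> St A \<U>" using U by (auto simp: St_def)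
      then have "{A \<in> \<A>. U \<inter> A \<noteq> {}} \<subseteq> {A' \<in> \<A>. St A \<U> \<inter> A' \<noteq> {}}" by blast
      then show ?thesis using \<U>(2) A(1) finite_subset by blast
    next
      case False
      then have "{A \<in> \<A>. U \<inter> A \<noteq> {}} = {}" by blast
      then show ?thesis by (simp only: finite.emptyI)
    qed
    then show ?thesis using \<U>(1) by (auto simp: unif_locally_finite_def)
  qed
  then show ?thesis
    using assms unfolding unif_strongly_paracompact_def unif_paracompact_def by blast
qed

lemma sf_unif_subset:
  assumes "covering_uniformity X \<mu>"
  shows "sf_unif X \<mu> \<subseteq> \<mu>"
  using uniform_cover_upward[OF assms] by (auto simp: sf_unif_def)

lemma unif_strongly_paracompact_imp_sf_unif:
  assumes cu: "covering_uniformity X \<mu>" and usp: "unif_strongly_paracompact X \<mu>"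
  shows "\<mu> = sf_unif X \<mu>"
proof
  show "\<mu> \<subseteq> sf_unif X \<mu>"
  proof
    fix \<U> assume \<U>: "\<U> \<in> \<mu>"
    have covU: "is_cover X \<U>" using uniform_cover_Union[OF cu \<U>] by (simp add: is_cover_def)
    have "\<exists>\<B>\<in>\<mu>. open_cover X \<mu> \<B> \<and> star_finite \<B> \<and> refines \<B> \<U>"
    proof (cases "X = {}")
      \<comment> \<open>On the empty space \<open>\<A>\<close> below may be the empty family, which \<open>{{}}\<close> does not refine.\<close>
      case True
      then have sub: "\<U> \<subseteq> {{}}" using covU by (auto simp: is_cover_def)
      then have "\<forall>U\<in>\<U>. openin (unif_topology X \<mu>) U" by auto
      moreover have "star_finite \<U>"
        using finite_subset[OF sub] by (auto simp: star_finite_def)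
      ultimately show ?thesis
        using covU \<U> by (intro bexI[of _ \<U>]) (auto simp: open_cover_def refines_def)
    next
      case False
      obtain \<V>1 where \<V>1: "\<V>1 \<in> \<mu>" "star_refines \<V>1 \<U>"
        using ex_common_star_refinement[OF cu \<U> \<U>] by blast
      obtain \<G> where \<G>: "\<G> \<in> \<mu>" "open_cover X \<mu> \<G>" "refines \<G> \<V>1"
        using ex_open_uniform_refinement[OF cu \<V>1(1)] by blast
      obtain \<A> where \<A>: "open_cover X \<mu> \<A>" "refines \<A> \<G>" "unif_star_finite \<mu> \<A>"
        using usp \<G>(2) unfolding unif_strongly_paracompact_def by blast
      obtain \<W> where \<W>: "\<W> \<in> \<mu>" "\<forall>A\<in>\<A>. finite {A' \<in> \<A>. St A \<W> \<inter> A' \<noteq> {}}"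
        using \<A>(3) by (auto simp: unif_star_finite_def)
      \<comment> \<open>Refining \<open>\<V>1\<close> keeps the thickened members of \<open>\<A>\<close> inside members of \<open>\<U>\<close>; star-refining \<open>\<W>\<close>
        forces members of \<open>\<A>\<close> whose thickenings meet to be \<open>\<W>\<close>-close.\<close>
      obtain \<V>0 where \<V>0: "\<V>0 \<in> \<mu>" "star_refines \<V>0 \<W>" "star_refines \<V>0 \<V>1"
        using ex_common_star_refinement[OF cu \<W>(1) \<V>1(1)] by blast
      obtain \<V> where \<V>: "\<V> \<in> \<mu>" "open_cover X \<mu> \<V>" "refines \<V> \<V>0"
        using ex_open_uniform_refinement[OF cu \<V>0(1)] by blast
      define \<B> where "\<B> = (\<lambda>A. St A \<V>) ` \<A>"
      have UA: "\<Union>\<A> = X" and UV: "\<Union>\<V> = X"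
        using \<A>(1) \<V>(2) by (auto simp: open_cover_def is_cover_def)
      have ref: "refines \<V> \<B>"
        unfolding refines_def
      proof
        fix V assume V: "V \<in> \<V>"
        have "\<exists>A\<in>\<A>. V \<subseteq> St A \<V>"
        proof (cases "V = {}")
          case True
          then show ?thesis using UA \<open>X \<noteq> {}\<close> by blast
        next
          case False
          then obtain A where "A \<in> \<A>" "V \<inter> A \<noteq> {}" using UA UV V by blast
          then show ?thesis using V by (auto simp: St_def)
        qed
        then show "\<exists>B\<in>\<B>. V \<subseteq> B" by (auto simp: \<B>_def)
      qed
      have "\<Union>\<B> \<subseteq> X" using UV by (auto simp: \<B>_def St_def)
      moreover have "X \<subseteq> \<Union>\<B>" using UV ref unfolding refines_def by blast
      ultimately have covB: "is_cover X \<B>" by (auto simp: is_cover_def)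
      have "openin (unif_topology X \<mu>) (St A \<V>)" for A
        unfolding St_def using \<V>(2) by (intro openin_Union) (auto simp: open_cover_def)
      then have openB: "open_cover X \<mu> \<B>" using covB by (auto simp: open_cover_def \<B>_def)
      have "refines \<B> \<U>"
        unfolding refines_def
      proof
        fix B assume "B \<in> \<B>"
        then obtain A where A: "A \<in> \<A>" "B = St A \<V>" by (auto simp: \<B>_def)
        obtain V1 where V1: "V1 \<in> \<V>1" "A \<subseteq> V1"
          using refines_trans[OF \<A>(2) \<G>(3)] A(1) by (auto simp: refines_def)
        obtain U where U: "U \<in> \<U>" "St V1 \<V>1 \<subseteq> U"
          using \<V>1(2) V1(1) by (auto simp: star_refines_def refines_def)
        have "B \<subseteq> St V1 \<V>1"
          unfolding A(2) using V1(2) refines_trans[OF \<V>(3) star_refines_imp_refines[OF \<V>0(3)]]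
          by (rule St_mono)
        then show "\<exists>U\<in>\<U>. B \<subseteq> U" using U by blast
      qed
      moreover have "star_finite \<B>"
        unfolding star_finite_def
      proof
        fix B assume "B \<in> \<B>"
        then obtain A where A: "A \<in> \<A>" "B = St A \<V>" by (auto simp: \<B>_def)
        have near: "St A \<W> \<inter> A' \<noteq> {}" if meet: "St A \<V> \<inter> St A' \<V> \<noteq> {}" for A'
        proof -
          obtain y where "y \<in> St A \<V>" "y \<in> St A' \<V>" using meet by blast
          then obtain V V' where v: "V \<in> \<V>" "V \<inter> A \<noteq> {}" "V' \<in> \<V>" "V' \<inter> A' \<noteq> {}" "V \<inter> V' \<noteq> {}"
            unfolding St_def by blast
          obtain P where P: "P \<in> \<V>0" "V \<subseteq> P" using \<V>(3) v(1) by (auto simp: refines_def)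
          obtain W where W: "W \<in> \<W>" "St P \<V>0 \<subseteq> W"
            using \<V>0(2) P(1) by (auto simp: star_refines_def refines_def)
          have "St V \<V> \<subseteq> W" using St_mono[OF P(2) \<V>(3)] W(2) by blast
          then have "V \<subseteq> W" "V' \<subseteq> W" using v by (auto simp: St_def)
          moreover from this have "W \<subseteq> St A \<W>" using v(2) W(1) unfolding St_def by blast
          ultimately show ?thesis using v(4) by blast
        qed
        have "{B' \<in> \<B>. B \<inter> B' \<noteq> {}} \<subseteq> (\<lambda>A. St A \<V>) ` {A' \<in> \<A>. St A \<W> \<inter> A' \<noteq> {}}"
          using near by (auto simp: \<B>_def A(2))
        then show "finite {B' \<in> \<B>. B \<inter> B' \<noteq> {}}"
          using \<W>(2) A(1) by (meson finite_imageI finite_subset)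
      qed
      moreover have "\<B> \<in> \<mu>" using uniform_cover_upward[OF cu \<V>(1) covB ref] .
      ultimately show ?thesis using openB by blast
    qed
    then show "\<U> \<in> sf_unif X \<mu>" using covU by (auto simp: sf_unif_def)
  qed
qed (rule sf_unif_subset[OF cu])

section \<open>Filters and cofinal completeness\<close>

text \<open>
  If a set that meets every member of a filter is covered by finitely many sets, then one of
  these sets meets every member of the filter.
\<close>

lemma filter_meets_finite_Union:
  assumes "finite \<H>" "A \<subseteq> \<Union>\<H>" "\<forall>F. eventually (\<lambda>x. x \<in> F) \<F> \<longrightarrow> F \<inter> A \<noteq> {}"
  shows "\<exists>H\<in>\<H>. \<forall>F. eventually (\<lambda>x. x \<in> F) \<F> \<longrightarrow> F \<inter> H \<noteq> {}"
proof (rule ccontr)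
  assume neg: "\<not> ?thesis"
  have "\<forall>H\<in>\<H>. eventually (\<lambda>x. x \<notin> H) \<F>"
  proof
    fix H assume "H \<in> \<H>"
    then obtain F where "eventually (\<lambda>x. x \<in> F) \<F>" "F \<inter> H = {}" using neg by blast
    then show "eventually (\<lambda>x. x \<notin> H) \<F>" by (auto elim: eventually_mono)
  qed
  then have "eventually (\<lambda>x. \<forall>H\<in>\<H>. x \<notin> H) \<F>"
    using assms(1) by (simp add: eventually_ball_finite)
  then have "eventually (\<lambda>x. x \<in> - \<Union>\<H>) \<F>" by (auto elim: eventually_mono)
  then have "- \<Union>\<H> \<inter> A \<noteq> {}" using assms(3) by simp
  then show False using assms(2) by auto
qed

lemma unif_paracompact_imp_cofinally_complete:
  assumes cu: "covering_uniformity X \<mu>" and up: "unif_paracompact X \<mu>"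
  shows "cofinally_complete X \<mu>"
  unfolding cofinally_complete_def
proof (intro allI impI, rule ccontr)
  fix \<F> :: "'a filter"
  let ?T = "unif_topology X \<mu>"
  assume \<F>: "filter_on X \<F> \<and> cofinally_Cauchy \<mu> \<F>"
    and no: "\<nexists>x. cluster_point ?T \<F> x"
  define \<G> where "\<G> = {X - ?T closure_of F | F. eventually (\<lambda>x. x \<in> F) \<F>}"
  have "X \<subseteq> \<Union>\<G>"
  proof
    fix x assume "x \<in> X"
    then obtain F where "eventually (\<lambda>y. y \<in> F) \<F>" "x \<notin> ?T closure_of F"
      using no by (auto simp: cluster_point_def topspace_unif_topology[OF cu])
    then show "x \<in> \<Union>\<G>" using \<open>x \<in> X\<close> by (auto simp: \<G>_def)
  qed
  then have "is_cover X \<G>" by (auto simp: is_cover_def \<G>_def)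
  moreover have "openin ?T G" if "G \<in> \<G>" for G
    using that closedin_closure_of[of ?T]
    by (auto simp: \<G>_def closedin_def topspace_unif_topology[OF cu])
  ultimately have "open_cover X \<mu> \<G>" by (simp add: open_cover_def)
  then obtain \<A> where \<A>: "open_cover X \<mu> \<A>" "refines \<A> \<G>" "unif_locally_finite \<mu> \<A>"
    using up unfolding unif_paracompact_def by blast
  obtain \<U> where \<U>: "\<U> \<in> \<mu>" "\<forall>U\<in>\<U>. finite {A \<in> \<A>. U \<inter> A \<noteq> {}}"
    using \<A>(3) by (auto simp: unif_locally_finite_def)
  obtain U where U: "U \<in> \<U>" "\<forall>F. eventually (\<lambda>x. x \<in> F) \<F> \<longrightarrow> F \<inter> U \<noteq> {}"
    using \<F> \<U>(1) unfolding cofinally_Cauchy_def by blast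
  have "U \<subseteq> \<Union>{A \<in> \<A>. U \<inter> A \<noteq> {}}"
    using \<A>(1) uniform_cover_Union[OF cu \<U>(1)] U(1) by (fastforce simp: open_cover_def is_cover_def)
  from filter_meets_finite_Union[OF bspec[OF \<U>(2) U(1)] this U(2)]
  obtain A where "A \<in> {A \<in> \<A>. U \<inter> A \<noteq> {}}"
      and meets: "\<forall>F. eventually (\<lambda>x. x \<in> F) \<F> \<longrightarrow> F \<inter> A \<noteq> {}"
    by (rule bexE)
  then have A: "A \<in> \<A>" by simp
  obtain G where "G \<in> \<G>" "A \<subseteq> G" using \<A>(2) A by (auto simp: refines_def)
  then obtain F where F: "eventually (\<lambda>x. x \<in> F) \<F>" "A \<subseteq> X - ?T closure_of F"
    unfolding \<G>_def by blast
  have "eventually (\<lambda>x. x \<in> F \<inter> X) \<F>"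
    using F(1) \<F> by (auto simp: filter_on_def intro: eventually_conj)
  then have "(F \<inter> X) \<inter> A \<noteq> {}" using meets by blast
  moreover have "F \<inter> X \<subseteq> ?T closure_of F"
    using closure_of_subset_Int[of ?T F] by (auto simp: topspace_unif_topology[OF cu])
  ultimately show False using F(2) by blast
qed

lemma cofinally_Bourbaki_Cauchy_imp_cofinally_Cauchy:
  assumes sf: "\<mu> = sf_unif X \<mu>" and bc: "cofinally_Bourbaki_Cauchy \<mu> \<F>"
  shows "cofinally_Cauchy \<mu> \<F>"
  unfolding cofinally_Cauchy_def
proof
  fix \<U> assume "\<U> \<in> \<mu>"
  then obtain \<V> where \<V>: "\<V> \<in> \<mu>" "star_finite \<V>" "refines \<V> \<U>"
    using sf by (auto simp: sf_unif_def)
  from bspec[OF bc[unfolded cofinally_Bourbaki_Cauchy_def] \<V>(1)]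
  obtain m V where V: "V \<in> \<V>"
      and meets: "\<forall>F. eventually (\<lambda>x. x \<in> F) \<F> \<longrightarrow> F \<inter> St_iter m V \<V> \<noteq> {}"
    by (elim exE bexE)
  obtain \<H> where \<H>: "finite \<H>" "\<H> \<subseteq> \<V>" "St_iter m V \<V> = \<Union>\<H>"
    using star_finite_St_iter[OF \<V>(2) V, of m] by (elim exE conjE)
  from filter_meets_finite_Union[OF \<H>(1) equalityD1[OF \<H>(3)] meets]
  obtain H where H: "H \<in> \<H>" "\<forall>F. eventually (\<lambda>x. x \<in> F) \<F> \<longrightarrow> F \<inter> H \<noteq> {}"
    by (rule bexE)
  obtain U where U: "U \<in> \<U>" "H \<subseteq> U" using \<V>(3) \<H>(2) H(1) unfolding refines_def by blast
  have "F \<inter> U \<noteq> {}" if "eventually (\<lambda>x. x \<in> F) \<F>" for F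
    using H(2)[rule_format, OF that] U(2) by blast
  then show "\<exists>U\<in>\<U>. \<forall>F. eventually (\<lambda>x. x \<in> F) \<F> \<longrightarrow> F \<inter> U \<noteq> {}"
    using U(1) by (intro bexI[of _ U] allI impI)
qed

lemma cofinally_complete_imp_cofinally_Bourbaki_complete:
  assumes "cofinally_complete X \<mu>" "\<mu> = sf_unif X \<mu>"
  shows "cofinally_Bourbaki_complete X \<mu>"
  unfolding cofinally_Bourbaki_complete_def
proof (intro allI impI)
  fix \<F> assume \<F>: "filter_on X \<F> \<and> cofinally_Bourbaki_Cauchy \<mu> \<F>"
  then have "cofinally_Cauchy \<mu> \<F>"
    using cofinally_Bourbaki_Cauchy_imp_cofinally_Cauchy[OF assms(2)] by simp
  then show "\<exists>x. cluster_point (unif_topology X \<mu>) \<F> x"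
    using assms(1) \<F> by (simp add: cofinally_complete_def)
qed

section \<open>Cofinal Bourbaki-completeness and uniformly star-finite refinements\<close>

text \<open>
  Otherwise, the filter generated by the complements of the finite unions from \<open>\<G>\<close> would be
  cofinally Bourbaki-Cauchy without a cluster point.
\<close>

lemma ex_iterated_stars_finitely_covered:
  assumes cu: "covering_uniformity X \<mu>" and bc: "cofinally_Bourbaki_complete X \<mu>"
    and \<G>: "open_cover X \<mu> \<G>"
  shows "\<exists>\<U>\<in>\<mu>. open_cover X \<mu> \<U> \<and>
           (\<forall>m. \<forall>U\<in>\<U>. \<exists>\<H>. finite \<H> \<and> \<H> \<subseteq> \<G> \<and> St_iter m U \<U> \<subseteq> \<Union>\<H>)"
proof (rule ccontr)
  let ?T = "unif_topology X \<mu>"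
  let ?Fin = "{\<H>. finite \<H> \<and> \<H> \<subseteq> \<G>}"
  define small where "small S \<longleftrightarrow> (\<exists>\<H>. finite \<H> \<and> \<H> \<subseteq> \<G> \<and> S \<subseteq> \<Union>\<H>)" for S
  assume "\<not> ?thesis"
  then have neg: "\<not> (\<exists>\<U>\<in>\<mu>. open_cover X \<mu> \<U> \<and> (\<forall>m. \<forall>U\<in>\<U>. small (St_iter m U \<U>)))"
    unfolding small_def .
  have small_subset: "small S" if "small T" "S \<subseteq> T" for S T
    using that unfolding small_def by (meson order_trans)
  have large: "\<exists>m. \<exists>U\<in>\<U>. \<not> small (St_iter m U \<U>)" if \<U>: "\<U> \<in> \<mu>" for \<U>
  proof -
    obtain \<V> where \<V>: "\<V> \<in> \<mu>" "open_cover X \<mu> \<V>" "refines \<V> \<U>"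
      using ex_open_uniform_refinement[OF cu \<U>] by blast
    then obtain m V where V: "V \<in> \<V>" "\<not> small (St_iter m V \<V>)"
      using neg by blast
    obtain U where U: "U \<in> \<U>" "V \<subseteq> U" using \<V>(3) V(1) by (auto simp: refines_def)
    have "\<not> small (St_iter m U \<U>)"
      using V(2) small_subset St_iter_mono[OF U(2) \<V>(3)] by blast
    then show ?thesis using U(1) by blast
  qed
  define \<F> where "\<F> = (INF \<H>\<in>?Fin. principal (X - \<Union>\<H>))"
  have ev: "eventually P \<F> \<longleftrightarrow> (\<exists>\<H>\<in>?Fin. \<forall>x\<in>X - \<Union>\<H>. P x)" for P
    unfolding \<F>_def
  proof (subst eventually_INF_base)
    show "?Fin \<noteq> {}" by blast
    fix \<H> \<K> assume "\<H> \<in> ?Fin" "\<K> \<in> ?Fin"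
    then show "\<exists>\<L>\<in>?Fin. principal (X - \<Union>\<L>) \<le> inf (principal (X - \<Union>\<H>)) (principal (X - \<Union>\<K>))"
      by (intro bexI[of _ "\<H> \<union> \<K>"]) auto
  qed (simp add: eventually_principal)
  \<comment> \<open>A subset of \<open>X\<close> that no finite union from \<open>\<G>\<close> covers meets every set of the filter.\<close>
  have meets: "F \<inter> St_iter m U \<U> \<noteq> {}"
    if \<U>: "\<U> \<in> \<mu>" "U \<in> \<U>" and l: "\<not> small (St_iter m U \<U>)"
      and F: "eventually (\<lambda>x. x \<in> F) \<F>" for \<U> m U F
  proof -
    obtain \<H> where \<H>: "\<H> \<in> ?Fin" "\<forall>x\<in>X - \<Union>\<H>. x \<in> F" using F[unfolded ev] by (rule bexE)
    have "St_iter m U \<U> \<subseteq> X"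
      using uniform_cover_Union[OF cu \<U>(1)] \<U>(2) by (cases m) (auto simp: St_def)
    moreover have "\<not> St_iter m U \<U> \<subseteq> \<Union>\<H>" using l \<H>(1) by (auto simp: small_def)
    ultimately show ?thesis using \<H>(2) by blast
  qed
  have "cofinally_Bourbaki_Cauchy \<mu> \<F>"
    unfolding cofinally_Bourbaki_Cauchy_def
  proof
    fix \<U> assume \<U>: "\<U> \<in> \<mu>"
    then obtain m U where U: "U \<in> \<U>" "\<not> small (St_iter m U \<U>)"
      using large by blast
    show "\<exists>m. \<exists>U\<in>\<U>. \<forall>F. eventually (\<lambda>x. x \<in> F) \<F> \<longrightarrow> F \<inter> St_iter m U \<U> \<noteq> {}"
      using meets[OF \<U> U] U(1) by (intro exI[of _ m] bexI[of _ U]) simp_all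
  qed
  moreover have "filter_on X \<F>"
  proof -
    have "\<F> \<noteq> bot"
    proof
      assume "\<F> = bot"
      then have F: "eventually (\<lambda>x. x \<in> {}) \<F>" by simp
      obtain \<U> where \<U>: "\<U> \<in> \<mu>" using cu by (auto simp: covering_uniformity_def)
      then obtain m U where U: "U \<in> \<U>" "\<not> small (St_iter m U \<U>)"
        using large by blast
      show False using meets[OF \<U> U F] by simp
    qed
    moreover have "eventually (\<lambda>x. x \<in> X) \<F>"
      unfolding ev by (rule bexI[of _ "{}"]) auto
    ultimately show ?thesis by (simp add: filter_on_def)
  qed
  ultimately obtain x where x: "cluster_point ?T \<F> x"
    using bc unfolding cofinally_Bourbaki_complete_def by blast
  then have "x \<in> X" by (simp add: cluster_point_def topspace_unif_topology[OF cu])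
  then obtain G where G: "G \<in> \<G>" "x \<in> G" "openin ?T G"
    using \<G> by (auto simp: open_cover_def is_cover_def)
  have "eventually (\<lambda>y. y \<in> X - G) \<F>"
    unfolding ev using G(1) by (intro bexI[of _ "{G}"]) auto
  then have "x \<in> ?T closure_of (X - G)" using x by (simp add: cluster_point_def)
  then show False using G(2,3) by (auto simp: in_closure_of)
qed

lemma cofinally_Bourbaki_complete_imp_unif_strongly_paracompact:
  assumes cu: "covering_uniformity X \<mu>" and bc: "cofinally_Bourbaki_complete X \<mu>"
  shows "unif_strongly_paracompact X \<mu>"
  unfolding unif_strongly_paracompact_def
proof (intro allI impI)
  fix \<G> assume \<G>: "open_cover X \<mu> \<G>"
  from ex_iterated_stars_finitely_covered[OF cu bc \<G>]
  obtain \<U> where "\<U> \<in> \<mu>" and "open_cover X \<mu> \<U> \<and>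
      (\<forall>m. \<forall>U\<in>\<U>. \<exists>\<H>. finite \<H> \<and> \<H> \<subseteq> \<G> \<and> St_iter m U \<U> \<subseteq> \<Union>\<H>)"
    by (rule bexE)
  then have \<U>: "\<U> \<in> \<mu>" "open_cover X \<mu> \<U>"
    and fin: "\<forall>m. \<forall>U\<in>\<U>. \<exists>\<H>. finite \<H> \<and> \<H> \<subseteq> \<G> \<and> St_iter m U \<U> \<subseteq> \<Union>\<H>"
    by simp_all
  define \<H> where "\<H> m U = (SOME \<K>. finite \<K> \<and> \<K> \<subseteq> \<G> \<and> St_iter m U \<U> \<subseteq> \<Union>\<K>)" for m U
  have \<H>: "finite (\<H> m U)" "\<H> m U \<subseteq> \<G>" "St_iter m U \<U> \<subseteq> \<Union>(\<H> m U)" if U: "U \<in> \<U>" for m U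
    using someI_ex[OF bspec[OF spec[OF fin, of m] U]] by (simp_all add: \<H>_def)
  obtain r and n :: "'a set \<Rightarrow> nat" where
      r: "\<forall>U\<in>\<U>. r U \<in> \<U> \<and> U \<subseteq> St_iter (n U) (r U) \<U>"
    and adj: "\<forall>U\<in>\<U>. \<forall>V\<in>\<U>. U \<inter> V \<noteq> {} \<longrightarrow> r U = r V \<and> n V \<le> Suc (n U)"
    using ex_chain_levels[of \<U>] by blast
  define layer where "layer b m = \<Union>{U \<in> \<U>. r U = b \<and> n U = m}" for b m
  define traces where "traces b m = (\<lambda>G. G \<inter> layer b m) ` \<H> m b" for b m
  define \<A> where "\<A> = (\<Union>b\<in>\<U>. \<Union>m. traces b m)"
  have UG: "\<Union>\<G> = X" and UU: "\<Union>\<U> = X"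
    using \<G> \<U>(2) by (auto simp: open_cover_def is_cover_def)
  have \<A>E: "\<exists>b m G. b \<in> \<U> \<and> G \<in> \<H> m b \<and> A = G \<inter> layer b m" if "A \<in> \<A>" for A
    using that by (auto simp: \<A>_def traces_def)
  have ref: "refines \<A> \<G>"
    unfolding refines_def
  proof
    fix A assume "A \<in> \<A>"
    then obtain b m G where "b \<in> \<U>" "G \<in> \<H> m b" "A = G \<inter> layer b m" using \<A>E by blast
    then show "\<exists>G\<in>\<G>. A \<subseteq> G" using \<H>(2)[of b m] by (intro bexI[of _ G]) auto
  qed
  have "X \<subseteq> \<Union>\<A>"
  proof
    fix x assume "x \<in> X"
    then obtain U where U: "U \<in> \<U>" "x \<in> U" using UU by blast
    then have "x \<in> layer (r U) (n U)" by (auto simp: layer_def)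
    moreover obtain G where "G \<in> \<H> (n U) (r U)" "x \<in> G"
      using r U \<H>(3)[of "r U" "n U"] by blast
    ultimately show "x \<in> \<Union>\<A>" using r U(1) by (auto simp: \<A>_def traces_def)
  qed
  moreover have "\<Union>\<A> \<subseteq> X" using ref UG by (auto simp: refines_def)
  moreover have "openin (unif_topology X \<mu>) A" if A: "A \<in> \<A>" for A
  proof -
    obtain b m G where "b \<in> \<U>" "G \<in> \<H> m b" and eq: "A = G \<inter> layer b m"
      using \<A>E[OF A] by blast
    then have "openin (unif_topology X \<mu>) G"
      using \<H>(2) \<G> by (auto simp: open_cover_def)
    moreover have "openin (unif_topology X \<mu>) (layer b m)"
      unfolding layer_def using \<U>(2) by (intro openin_Union) (auto simp: open_cover_def)
    ultimately show ?thesis unfolding eq by (rule openin_Int)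
  qed
  ultimately have "open_cover X \<mu> \<A>" by (auto simp: open_cover_def is_cover_def)
  moreover have "unif_star_finite \<mu> \<A>"
    unfolding unif_star_finite_def
  proof (intro bexI[OF _ \<U>(1)] ballI)
    fix A assume "A \<in> \<A>"
    then obtain b m G where b: "b \<in> \<U>" "A = G \<inter> layer b m" using \<A>E by blast
    have "A' \<in> (\<Union>k\<le>m + 2. traces b k)" if A': "A' \<in> \<A>" "St A \<U> \<inter> A' \<noteq> {}" for A'
    proof -
      obtain b' m' G' where b': "G' \<in> \<H> m' b'" "A' = G' \<inter> layer b' m'"
        using \<A>E[OF A'(1)] by blast
      obtain V where V: "V \<in> \<U>" "V \<inter> layer b m \<noteq> {}" "V \<inter> layer b' m' \<noteq> {}"
        using A'(2) unfolding b(2) b'(2) St_def by blast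
      obtain U where U: "U \<in> \<U>" "r U = b" "n U = m" "U \<inter> V \<noteq> {}"
        using V(2) by (auto simp: layer_def)
      obtain U' where U': "U' \<in> \<U>" "r U' = b'" "n U' = m'" "V \<inter> U' \<noteq> {}"
        using V(3) by (auto simp: layer_def)
      have "r U = r V \<and> n V \<le> Suc (n U)" using adj U(1,4) V(1) by blast
      moreover have "r V = r U' \<and> n U' \<le> Suc (n V)" using adj U'(1,4) V(1) by blast
      ultimately have "b' = b" "m' \<le> m + 2" using U U' by auto
      then show ?thesis using b' by (auto simp: traces_def)
    qed
    then have "{A' \<in> \<A>. St A \<U> \<inter> A' \<noteq> {}} \<subseteq> (\<Union>k\<le>m + 2. traces b k)" by blast
    moreover have "finite (\<Union>k\<le>m + 2. traces b k)"
      using \<H>(1)[OF b(1)] by (simp add: traces_def)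
    ultimately show "finite {A' \<in> \<A>. St A \<U> \<inter> A' \<noteq> {}}" by (rule finite_subset)
  qed
  ultimately show "\<exists>\<A>. open_cover X \<mu> \<A> \<and> refines \<A> \<G> \<and> unif_star_finite \<mu> \<A>"
    using ref by blast
qed

section \<open>The equivalence\<close>

theorem theorem1p2p28:
  fixes X :: "'a set" and \<mu> :: "'a set set set"
  assumes "hausdorff_uniform_space X \<mu>"
  shows "(unif_strongly_paracompact X \<mu> \<longleftrightarrow> unif_paracompact X \<mu> \<and> \<mu> = sf_unif X \<mu>)
       \<and> (unif_paracompact X \<mu> \<and> \<mu> = sf_unif X \<mu> \<longleftrightarrow> cofinally_complete X \<mu> \<and> \<mu> = sf_unif X \<mu>)
       \<and> (cofinally_complete X \<mu> \<and> \<mu> = sf_unif X \<mu> \<longleftrightarrow> cofinally_Bourbaki_complete X \<mu>)"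
proof -
  have cu: "covering_uniformity X \<mu>"
    using assms by (simp add: hausdorff_uniform_space_def)
  show ?thesis
    using unif_strongly_paracompact_imp_unif_paracompact[of X \<mu>]
      unif_strongly_paracompact_imp_sf_unif[OF cu]
      unif_paracompact_imp_cofinally_complete[OF cu]
      cofinally_complete_imp_cofinally_Bourbaki_complete[of X \<mu>]
      cofinally_Bourbaki_complete_imp_unif_strongly_paracompact[OF cu]
    by argo
qed

end
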